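(* Let $M\ge 1$ be an integer, $\alpha>0$, $\rho:\{1,2,\dots\}\to(0,\infty)$, and let $F_0$ be a probability distribution on $\mathbb{R}$ with density $f_0$. Let $F\sim\mathcal{PT}_M(\alpha,\rho,F_0)$ be a finite Pólya tree random distribution with random density $f$ and branching probabilities $Y_{mj}$. Then the Kullback-Leibler divergence between $f_0$ and $f$, $$\mathrm{KL}(f_0\,||\,f)=-\sum_{m=1}^M\sum_{j=1}^{2^m}(\log Y_{mj})\frac{1}{2^m}-M\log 2,$$ has mean and variance given by $$\mathrm{E}\{\mathrm{KL}(f_0\,||\,f)\}=\sum_{m=1}^M\left\{\psi_0(2\alpha\rho(m))-\psi_0(\alpha\rho(m))-\log 2\right\}$$ and $$\mathrm{Var}\{\mathrm{KL}(f_0\,||\,f)\}=\sum_{m=1}^M\frac{1}{2^m}\left\{\psi_1(\alpha\rho(m))-2\psi_1(2\alpha\rho(m))\right\}.$$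
   Context: $\psi_0(x)=\frac{d}{dx}\log\Gamma(x)$ is the digamma function and $\psi_1(x)=\frac{d^2}{dx^2}\log\Gamma(x)$ the trigamma function. For densities $f,g$ on $\mathbb{R}$, $\mathrm{KL}(f\,||\,g)=\int \log\{f(x)/g(x)\}f(x)\,dx$. Finite Pólya tree $\mathcal{PT}_M(\alpha,\rho,F_0)$: for $m=1,\dots,M$ and $j=1,\dots,2^m$ let $B_{mj}=\left(F_0^{-1}\left(\frac{j-1}{2^m}\right),F_0^{-1}\left(\frac{j}{2^m}\right)\right]$, with $F_0^{-1}(0)=-\infty$ and $F_0^{-1}(1)=\infty$, so that $B_{mj}$ is the disjoint union of $B_{m+1,2j-1}$ and $B_{m+1,2j}$. Let $Y_{m,2j-1}$, $m=1,\dots,M$, $j=1,\dots,2^{m-1}$, be independent random variables with $Y_{m,2j-1}\sim\mathrm{Beta}(\alpha\rho(m),\alpha\rho(m))$, and let $Y_{m,2j}=1-Y_{m,2j-1}$. These are branching probabilities: $Y_{m+1,2j-1}=F(B_{m+1,2j-1}\mid B_{mj})$ and $Y_{m+1,2j}=F(B_{m+1,2j}\mid B_{mj})$. The random distribution $F$ has density $f(x)=\left(\prod_{m=1}^M Y_{m,j_m(x)}\right)2^M f_0(x)$, where $j_m(x)$ is the index $j$ such that $x\in B_{mj}$. *)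

theory Defs
  imports "HOL-Probability.Probability"
begin

(* The digamma and trigamma functions are the library's Digamma = Polygamma 0 and Polygamma 1,
   the first and second derivatives of ln_Gamma on the positive reals. *)

text \<open>Kullback--Leibler divergence of densities with respect to Lebesgue measure. Points with
  \<open>f x = 0\<close> contribute \<open>0\<close>, the usual convention.\<close>

definition KL :: "(real \<Rightarrow> real) \<Rightarrow> (real \<Rightarrow> real) \<Rightarrow> real" where
  "KL f g = (LINT x|lborel. ln (f x / g x) * f x)"

text \<open>Agreement with \<open>KL_divergence\<close>, whose arguments are in the opposite order:\<close>

lemma KL_eq_KL_divergence:
  assumes "f \<in> borel_measurable lborel" "\<And>x. 0 \<le> f x"
    and "g \<in> borel_measurable lborel" "\<And>x. 0 \<le> g x"
    and "AE x in lborel. g x = 0 \<longrightarrow> f x = 0"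
  shows "KL f g = KL_divergence (exp 1) (density lborel g) (density lborel f)"
  using assms
  by (subst lborel.KL_density_density) (simp_all add: KL_def log_def mult.commute)

definition beta_density :: "real \<Rightarrow> real \<Rightarrow> real \<Rightarrow> real" where
  "beta_density a b y =
     (if 0 < y \<and> y < 1 then y powr (a - 1) * (1 - y) powr (b - 1) / Beta a b else 0)"

text \<open>The generalised inverse of the distribution function. The value at \<open>1\<close> is \<open>\<infinity>\<close> by
  convention, even if the support is bounded above.\<close>

definition quantile :: "real measure \<Rightarrow> real \<Rightarrow> ereal" where
  "quantile F0 p =
     (if p \<le> 0 then - \<infinity> else if p \<ge> 1 then \<infinity> else ereal (Inf {x. p \<le> cdf F0 x}))"

definition pt_cell :: "real measure \<Rightarrow> nat \<Rightarrow> nat \<Rightarrow> real set" where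
  "pt_cell F0 m j =
     {x. quantile F0 ((real j - 1) / 2 ^ m) < ereal x \<and> ereal x \<le> quantile F0 (real j / 2 ^ m)}"

definition pt_index :: "real measure \<Rightarrow> nat \<Rightarrow> real \<Rightarrow> nat" where
  "pt_index F0 m x = (THE j. j \<in> {1..2 ^ m} \<and> x \<in> pt_cell F0 m j)"

text \<open>\<open>F\<close> is the random distribution, \<open>f\<close> its random density and \<open>Y\<close> the array of branching
  probabilities, all defined on the probability space \<open>P\<close>; \<open>F0\<close> is the centring distribution
  and \<open>f0\<close> its density.\<close>

locale finite_polya_tree = prob_space P
  for P :: "'a measure" +
  fixes M :: nat and \<alpha> :: real and \<rho> :: "nat \<Rightarrow> real"
    and F0 :: "real measure" and f0 :: "real \<Rightarrow> real"
    and Y :: "nat \<Rightarrow> nat \<Rightarrow> 'a \<Rightarrow> real"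
    and F :: "'a \<Rightarrow> real measure" and f :: "'a \<Rightarrow> real \<Rightarrow> real"
  assumes Y_indep:
      "indep_vars (\<lambda>_. borel) (\<lambda>(m, j). Y m (2 * j - 1)) (SIGMA m:{1..M}. {1..2 ^ (m - 1)})"
    and Y_beta:
      "\<And>m j. m \<in> {1..M} \<Longrightarrow> j \<in> {1..2 ^ (m - 1)} \<Longrightarrow>
         distributed P lborel (Y m (2 * j - 1)) (beta_density (\<alpha> * \<rho> m) (\<alpha> * \<rho> m))"
    and Y_even:
      "\<And>m j \<omega>. m \<in> {1..M} \<Longrightarrow> j \<in> {1..2 ^ (m - 1)} \<Longrightarrow> \<omega> \<in> space P \<Longrightarrow>
         Y m (2 * j) \<omega> = 1 - Y m (2 * j - 1) \<omega>"
    and f_eq: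
      "\<And>\<omega> x. \<omega> \<in> space P \<Longrightarrow>
         f \<omega> x = (\<Prod>m = 1..M. Y m (pt_index F0 m x) \<omega>) * 2 ^ M * f0 x"
    and F_eq:
      "\<And>\<omega>. \<omega> \<in> space P \<Longrightarrow> F \<omega> = density lborel (f \<omega>)"

end

theory Submission
  imports Defs
begin

text \<open>Since \<open>F0\<close> has no atoms, every cell of level \<open>m\<close> has mass \<open>1 / 2 ^ m\<close>, so integrating
  \<open>ln (f0 x / f \<omega> x)\<close> level by level expresses the divergence through the \<open>ln (Y m j \<omega>)\<close>. Pairing
  siblings writes it as a constant minus a weighted sum of independent variables
  \<open>ln y + ln (1 - y)\<close> with \<open>y\<close> symmetric Beta. The moment generating function of such a variable is
  \<open>t \<mapsto> Beta (a + t) (a + t) / Beta a a\<close>, and its first two derivatives at \<open>0\<close> give the digamma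
  and trigamma terms.\<close>

section \<open>Moments from the moment generating function\<close>

text \<open>Exponential integrability at both \<open>h\<close> and \<open>- h\<close> dominates the
  exponential series of \<open>t * X\<close>, so expectation may be taken term by term. The moment
  generating function is then a power series whose coefficients carry the moments, and its
  derivatives at 0 read them off without differentiating under the integral sign.\<close>

lemma (in prob_space) moments_from_mgf:
  fixes X :: "'a \<Rightarrow> real" and h :: real
  assumes X [measurable]: "random_variable borel X" and h: "0 < h"
    and int: "\<And>t. \<bar>t\<bar> \<le> h \<Longrightarrow> integrable M (\<lambda>\<omega>. exp (t * X \<omega>))"
    and deriv: "\<And>t. \<bar>t\<bar> < h \<Longrightarrow>
      ((\<lambda>t. expectation (\<lambda>\<omega>. exp (t * X \<omega>))) has_real_derivative g t) (at t)"
    and deriv2: "(g has_real_derivative d) (at 0)"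
  shows "integrable M X" and "integrable M (\<lambda>\<omega>. (X \<omega>)\<^sup>2)"
    and "expectation X = g 0" and "expectation (\<lambda>\<omega>. (X \<omega>)\<^sup>2) = d"
proof -
  \<comment> \<open>Whatever the sign of \<open>X\<close>, one of the two summands is exp (h * |X|).
    Hence \<open>B\<close> bounds every partial sum of the series of exp (h * |X|), and each single
    term, which makes all powers of \<open>X\<close> integrable.\<close>
  define B where "B = (\<lambda>\<omega>. exp (h * X \<omega>) + exp (- h * X \<omega>))"
  have B_int: "integrable M B"
    unfolding B_def using h by (intro Bochner_Integration.integrable_add int) auto
  have exp_series: "(\<lambda>n. x ^ n / fact n) sums exp x" for x :: real
    using exp_converges[of x] by (simp add: divide_inverse mult.commute)
  have sum_le: "(\<Sum>n<k. h ^ n * \<bar>X \<omega>\<bar> ^ n / fact n) \<le> B \<omega>" for k \<omega>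
  proof -
    have "(\<Sum>n<k. (h * \<bar>X \<omega>\<bar>) ^ n / fact n) \<le> exp (h * \<bar>X \<omega>\<bar>)"
      using exp_series[of "h * \<bar>X \<omega>\<bar>"] h
      by (intro sum_le_suminf[OF sums_summable[OF exp_series], unfolded sums_unique[OF exp_series, symmetric]])
         auto
    also have "\<dots> \<le> B \<omega>"
      by (auto simp: B_def abs_if intro: add_increasing add_increasing2)
    finally show ?thesis by (simp add: power_mult_distrib)
  qed
  have term_le: "h ^ n * \<bar>X \<omega>\<bar> ^ n / fact n \<le> B \<omega>" for n \<omega>
  proof -
    have "h ^ n * \<bar>X \<omega>\<bar> ^ n / fact n \<le> (\<Sum>n<Suc n. h ^ n * \<bar>X \<omega>\<bar> ^ n / fact n)"
      using h by (auto intro!: sum_nonneg)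
    then show ?thesis using sum_le[of \<omega> "Suc n"] by linarith
  qed
  have pow_int: "integrable M (\<lambda>\<omega>. X \<omega> ^ n)" for n
  proof (rule Bochner_Integration.integrable_bound)
    show "integrable M (\<lambda>\<omega>. fact n / h ^ n * B \<omega>)" using B_int by simp
    show "AE \<omega> in M. norm (X \<omega> ^ n) \<le> norm (fact n / h ^ n * B \<omega>)"
    proof (rule AE_I2)
      fix \<omega>
      have "\<bar>X \<omega>\<bar> ^ n \<le> fact n / h ^ n * B \<omega>"
        using term_le[of n \<omega>] h by (simp add: field_simps)
      then show "norm (X \<omega> ^ n) \<le> norm (fact n / h ^ n * B \<omega>)"
        unfolding real_norm_def power_abs by (rule order.trans[OF _ abs_ge_self])
    qed
  qed simp
  define c where "c = (\<lambda>n. expectation (\<lambda>\<omega>. X \<omega> ^ n) / fact n)"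
  have c_sums: "(\<lambda>n. c n * t ^ n) sums expectation (\<lambda>\<omega>. exp (t * X \<omega>))" if t: "norm t < h" for t
  proof -
    have le: "\<bar>t\<bar> ^ n * \<bar>X \<omega>\<bar> ^ n / fact n \<le> h ^ n * \<bar>X \<omega>\<bar> ^ n / fact n" for n \<omega>
      using t by (intro divide_right_mono mult_right_mono power_mono) auto
    have int': "integrable M (\<lambda>\<omega>. (t * X \<omega>) ^ n / fact n)" for n
      using pow_int[of n] by (simp add: power_mult_distrib)
    have norm_eq: "norm ((t * X \<omega>) ^ n / fact n) = \<bar>t\<bar> ^ n * \<bar>X \<omega>\<bar> ^ n / fact n" for n \<omega>
      by (simp add: power_abs abs_mult power_mult_distrib)
    have "(\<lambda>n. expectation (\<lambda>\<omega>. (t * X \<omega>) ^ n / fact n)) sums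
        expectation (\<lambda>\<omega>. \<Sum>n. (t * X \<omega>) ^ n / fact n)"
    proof (rule sums_integral[OF int'])
      show "AE \<omega> in M. summable (\<lambda>n. norm ((t * X \<omega>) ^ n / fact n))"
      proof (rule AE_I2)
        fix \<omega>
        show "summable (\<lambda>n. norm ((t * X \<omega>) ^ n / fact n))"
          using sums_summable[OF exp_series[of "\<bar>t * X \<omega>\<bar>"]] by (simp add: power_abs)
      qed
      \<comment> \<open>The bound \<open>B\<close> does not depend on the number of terms, so the
        partial sums of expected norms stay below \<open>expectation B\<close>. This licenses the
        exchange of sum and expectation.\<close>
      show "summable (\<lambda>n. expectation (\<lambda>\<omega>. norm ((t * X \<omega>) ^ n / fact n)))"
      proof (rule summableI_nonneg_bounded)
        fix k
        have "(\<Sum>n<k. expectation (\<lambda>\<omega>. norm ((t * X \<omega>) ^ n / fact n))) =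
            expectation (\<lambda>\<omega>. \<Sum>n<k. norm ((t * X \<omega>) ^ n / fact n))"
          using int' by (intro Bochner_Integration.integral_sum[symmetric] integrable_norm)
        also have "\<dots> \<le> expectation B"
        proof (rule integral_mono)
          show "integrable M (\<lambda>\<omega>. \<Sum>n<k. norm ((t * X \<omega>) ^ n / fact n))"
            using int' by (intro Bochner_Integration.integrable_sum integrable_norm)
          fix \<omega>
          show "(\<Sum>n<k. norm ((t * X \<omega>) ^ n / fact n)) \<le> B \<omega>"
            unfolding norm_eq by (rule order.trans[OF sum_mono[OF le] sum_le])
        qed (rule B_int)
        finally show "(\<Sum>n<k. expectation (\<lambda>\<omega>. norm ((t * X \<omega>) ^ n / fact n))) \<le> expectation B" .
      qed simp
    qed
    also have "(\<lambda>n. expectation (\<lambda>\<omega>. (t * X \<omega>) ^ n / fact n)) = (\<lambda>n. c n * t ^ n)"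
      by (simp add: c_def power_mult_distrib mult.commute)
    also have "(\<lambda>\<omega>. \<Sum>n. (t * X \<omega>) ^ n / fact n) = (\<lambda>\<omega>. exp (t * X \<omega>))"
      by (simp add: sums_unique[OF exp_series, symmetric])
    finally show ?thesis .
  qed
  \<comment> \<open>Termwise differentiation of a power series inside its disc must agree with the
    given derivatives. At 0 the constant terms are \<open>diffs c 0 = c 1\<close>, the mean, and
    \<open>diffs (diffs c) 0 = 2 * c 2\<close>, the second moment.\<close>
  have d_sums: "(\<lambda>n. diffs c n * t ^ n) sums g t" if "norm t < h" for t
    using that by (intro termdiffs_sums_strong[OF c_sums deriv]) auto
  have dd_sums: "(\<lambda>n. diffs (diffs c) n * 0 ^ n) sums d"
    using h by (intro termdiffs_sums_strong[OF d_sums deriv2]) auto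
  have "diffs c 0 = g 0"
    using d_sums[of 0] h powser_sums_zero[of "diffs c"] sums_unique2 by fastforce
  then show "expectation X = g 0" by (simp add: diffs_def c_def)
  have "diffs (diffs c) 0 = d"
    using dd_sums powser_sums_zero[of "diffs (diffs c)"] sums_unique2 by fastforce
  then show "expectation (\<lambda>\<omega>. (X \<omega>)\<^sup>2) = d"
    by (simp add: diffs_def c_def numeral_2_eq_2)
  show "integrable M X" "integrable M (\<lambda>\<omega>. (X \<omega>)\<^sup>2)"
    using pow_int[of 1] pow_int[of 2] by simp_all
qed

section \<open>Variances of affine images and independent sums\<close>

text \<open>The library's \<open>variance_affine\<close> also asks for a density of \<open>X\<close>.\<close>

lemma (in prob_space) variance_affine_integrable:
  fixes X :: "'a \<Rightarrow> real"
  assumes "integrable M X"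
  shows "variance (\<lambda>\<omega>. a + b * X \<omega>) = b\<^sup>2 * variance X"
proof -
  have "expectation (\<lambda>\<omega>. a + b * X \<omega>) = a + b * expectation X"
    using assms by (simp add: prob_space)
  moreover have "(a + b * x - (a + b * y))\<^sup>2 = b\<^sup>2 * (x - y)\<^sup>2" for x y
    by (simp add: power_mult_distrib flip: right_diff_distrib)
  ultimately show ?thesis by simp
qed

text \<open>The square of the sum expands into pairwise products. Diagonal ones are integrable by
  \<open>int2\<close>, off-diagonal ones by independence, which also makes their covariances
  vanish.\<close>

lemma (in prob_space) indep_vars_sum_square_integrable_variance:
  fixes X :: "'i \<Rightarrow> 'a \<Rightarrow> real"
  assumes I: "finite I" and ind: "indep_vars (\<lambda>_. borel) X I"
    and int: "\<And>i. i \<in> I \<Longrightarrow> integrable M (X i)"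
    and int2: "\<And>i. i \<in> I \<Longrightarrow> integrable M (\<lambda>\<omega>. (X i \<omega>)\<^sup>2)"
  shows "integrable M (\<lambda>\<omega>. (\<Sum>i\<in>I. X i \<omega>)\<^sup>2)"
    and "variance (\<lambda>\<omega>. \<Sum>i\<in>I. X i \<omega>) = (\<Sum>i\<in>I. variance (X i))"
proof -
  have prod: "integrable M (\<lambda>\<omega>. X i \<omega> * X j \<omega>) \<and>
      (i \<noteq> j \<longrightarrow> expectation (\<lambda>\<omega>. X i \<omega> * X j \<omega>) = expectation (X i) * expectation (X j))"
    if "i \<in> I" "j \<in> I" for i j
  proof (cases "i = j")
    case True
    then show ?thesis using int2[OF that(1)] by (simp add: power2_eq_square)
  next
    case False
    have ind': "indep_vars (\<lambda>_. borel) X {i, j}"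
      by (rule indep_vars_subset[OF ind]) (use that in auto)
    show ?thesis
      using indep_vars_lebesgue_integral[OF _ ind'] indep_vars_integrable[OF _ ind'] int that False
      by auto
  qed
  have sq: "(\<Sum>i\<in>I. X i \<omega>)\<^sup>2 = (\<Sum>i\<in>I. \<Sum>j\<in>I. X i \<omega> * X j \<omega>)" for \<omega>
    by (simp add: power2_eq_square sum_product)
  show sq_int: "integrable M (\<lambda>\<omega>. (\<Sum>i\<in>I. X i \<omega>)\<^sup>2)"
    unfolding sq using prod by (intro Bochner_Integration.integrable_sum) auto
  let ?E = "\<lambda>i. expectation (X i)"
  have "variance (\<lambda>\<omega>. \<Sum>i\<in>I. X i \<omega>) =
      expectation (\<lambda>\<omega>. (\<Sum>i\<in>I. X i \<omega>)\<^sup>2) - (\<Sum>i\<in>I. ?E i)\<^sup>2"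
    using int by (subst variance_eq[OF _ sq_int]) auto
  also have "\<dots> = (\<Sum>i\<in>I. \<Sum>j\<in>I. expectation (\<lambda>\<omega>. X i \<omega> * X j \<omega>) - ?E i * ?E j)"
    unfolding sq using prod
    by (simp add: Bochner_Integration.integral_sum power2_eq_square sum_product sum_subtractf)
  also have "\<dots> = (\<Sum>i\<in>I. \<Sum>j\<in>I. if i = j then variance (X i) else 0)"
  proof (intro sum.cong refl)
    fix i j assume "i \<in> I" "j \<in> I"
    then show "expectation (\<lambda>\<omega>. X i \<omega> * X j \<omega>) - ?E i * ?E j = (if i = j then variance (X i) else 0)"
      using prod variance_eq[OF int int2, of j] by (auto simp: power2_eq_square)
  qed
  also have "\<dots> = (\<Sum>i\<in>I. variance (X i))"
    using I by simp
  finally show "variance (\<lambda>\<omega>. \<Sum>i\<in>I. X i \<omega>) = (\<Sum>i\<in>I. variance (X i))" .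
qed

section \<open>Logarithmic moments of the symmetric Beta distribution\<close>

lemma beta_density_nonneg: "0 < a \<Longrightarrow> 0 < b \<Longrightarrow> 0 \<le> beta_density a b y"
  by (simp add: beta_density_def Beta_def)

text \<open>This is Euler's Beta integral with the endpoints dropped as a null set. At shifted
  parameters it also evaluates the moment generating function below.\<close>

lemma beta_density_integral:
  assumes a: "0 < a" and b: "0 < b"
  shows "has_bochner_integral lborel (beta_density a b) 1"
proof -
  let ?g = "\<lambda>y::real. y powr (a - 1) * (1 - y) powr (b - 1)"
  have B: "0 < Beta a b" using a b by (simp add: Beta_def)
  have "(?g has_integral Beta a b) {0..1}"
    using has_integral_Beta_real[OF a b] .
  then have "(?g has_integral Beta a b) {0<..<1}"
    by (simp add: has_integral_Icc_iff_Ioo)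
  then have "((\<lambda>y. ?g y / Beta a b) has_integral (Beta a b / Beta a b)) {0<..<1}"
    by (rule has_integral_divide)
  then have "((\<lambda>y. if y \<in> {0<..<1} then ?g y / Beta a b else 0) has_integral 1) UNIV"
    unfolding has_integral_restrict_UNIV using B by simp
  then have "(beta_density a b has_integral 1) UNIV"
    by (simp add: beta_density_def[abs_def])
  moreover have [measurable]: "beta_density a b \<in> borel_measurable borel"
    unfolding beta_density_def[abs_def] by measurable
  ultimately have "integral\<^sup>N lborel (beta_density a b) = ennreal 1"
    using a b by (intro nn_integral_has_integral_lborel) (auto simp: beta_density_nonneg)
  then show ?thesis
    using a b by (intro has_bochner_integral_nn_integral) (auto simp: beta_density_nonneg)
qed

text \<open>Here exp (t * W) is (Y * (1 - Y)) powr t, so weighting by it turns the density with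
  parameter \<open>a\<close> into a multiple of the one with parameter \<open>a + t\<close>. The
  multiple, a quotient of Beta values, is the moment generating function.\<close>

lemma (in prob_space) beta_log_moments:
  assumes a: "0 < a" and Y: "distributed M lborel Y (beta_density a a)"
  defines "W \<equiv> \<lambda>\<omega>. ln (Y \<omega>) + ln (1 - Y \<omega>)"
  shows "integrable M W" and "integrable M (\<lambda>\<omega>. (W \<omega>)\<^sup>2)"
    and "expectation W = 2 * (Digamma a - Digamma (2 * a))"
    and "variance W = 2 * Polygamma 1 a - 4 * Polygamma 1 (2 * a)"
proof -
  have Y_meas [measurable]: "random_variable borel Y"
    using distributed_measurable[OF Y] by simp
  have W_meas: "random_variable borel W" unfolding W_def by measurable
  define B where "B = (\<lambda>t. Beta (a + t) (a + t) / Beta a a)"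
  have Bpos: "0 < Beta a a" using a by (simp add: Beta_def)
  have mgf: "integrable M (\<lambda>\<omega>. exp (t * W \<omega>)) \<and> expectation (\<lambda>\<omega>. exp (t * W \<omega>)) = B t"
    if t: "\<bar>t\<bar> < a" for t
  proof -
    let ?g = "\<lambda>y. exp (t * (ln y + ln (1 - y))) :: real"
    have eq: "beta_density a a y * ?g y = beta_density (a + t) (a + t) y * B t" for y
    proof (cases "0 < y \<and> y < 1")
      case True
      then have "?g y = y powr t * (1 - y) powr t"
        by (simp add: powr_def exp_add[symmetric] algebra_simps)
      moreover have "y powr (a + t - 1) = y powr (a - 1) * y powr t"
        "(1 - y) powr (a + t - 1) = (1 - y) powr (a - 1) * (1 - y) powr t"
        by (simp_all add: powr_add[symmetric] algebra_simps)
      moreover have "0 < Beta (a + t) (a + t)" using t by (simp add: Beta_def)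
      ultimately show ?thesis using True by (simp add: beta_density_def B_def)
    qed (auto simp: beta_density_def)
    have "has_bochner_integral lborel (\<lambda>y. beta_density (a + t) (a + t) y * B t) (1 * B t)"
      using t by (intro has_bochner_integral_mult_left beta_density_integral) auto
    then have "has_bochner_integral lborel (\<lambda>y. beta_density a a y * ?g y) (B t)"
      by (simp add: eq)
    then show ?thesis
      unfolding W_def has_bochner_integral_iff
      using distributed_integrable[OF Y, of ?g] distributed_integral[OF Y, of ?g]
      by (auto simp: beta_density_nonneg a)
  qed
  \<comment> \<open>\<open>g\<close> is \<open>B\<close> times its logarithmic derivative: up to a
    constant, the logarithm of \<open>B t\<close> is 2 * ln_Gamma (a + t) - ln_Gamma (2 * a + 2 *
    t).\<close>
  define g where "g = (\<lambda>t. B t * (2 * (Digamma (a + t) - Digamma (2 * a + 2 * t))))"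
  have nonpole: "x \<notin> \<int>\<^sub>\<le>\<^sub>0" if "x > 0" for x :: real
    using that by (auto elim!: nonpos_Ints_cases)
  have B_deriv: "(B has_real_derivative g t) (at t)" if t: "\<bar>t\<bar> < a" for t
  proof -
    have pos: "0 < a + t" "0 < 2 * a + 2 * t" using t by auto
    have "Gamma (a + t) \<noteq> 0" "Gamma (2 * a + 2 * t) \<noteq> 0" "a + t + (a + t) = 2 * a + 2 * t"
      using pos by (auto simp: less_imp_neq[OF Gamma_real_pos, symmetric])
    moreover have "((\<lambda>t. Gamma (a + t) * Gamma (a + t) / Gamma (2 * a + 2 * t) / Beta a a)
        has_real_derivative g t) (at t)"
      unfolding g_def B_def Beta_def[of "a + t"]
      using calculation pos Bpos
      by (auto intro!: derivative_eq_intros nonpole simp: field_simps)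
    moreover have "B = (\<lambda>t. Gamma (a + t) * Gamma (a + t) / Gamma (2 * a + 2 * t) / Beta a a)"
    proof
      fix s
      have "a + s + (a + s) = 2 * a + 2 * s" by simp
      then show "B s = Gamma (a + s) * Gamma (a + s) / Gamma (2 * a + 2 * s) / Beta a a"
        by (simp only: B_def Beta_def[of "a + s"])
    qed
    ultimately show ?thesis by simp
  qed
  have B0: "B 0 = 1" using Bpos by (simp add: B_def)
  \<comment> \<open>By the product rule for \<open>g\<close> with B 0 = 1, the first summand is the
    squared mean of \<open>W\<close>, so the second is its variance.\<close>
  define d where "d = (2 * (Digamma a - Digamma (2 * a)))\<^sup>2
      + (2 * Polygamma 1 a - 4 * Polygamma 1 (2 * a))"
  have g_deriv: "(g has_real_derivative d) (at 0)"
    unfolding g_def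
    using B_deriv[of 0] a
    by (auto intro!: derivative_eq_intros nonpole simp: B0 g_def d_def power2_eq_square algebra_simps)
  \<comment> \<open>The generating function is controlled only on the open interval |t| < a, while
    \<open>moments_from_mgf\<close> asks for integrability up to and including \<open>h\<close>. The
    choice a / 2 keeps the closed interval inside.\<close>
  have deriv: "((\<lambda>t. expectation (\<lambda>\<omega>. exp (t * W \<omega>))) has_real_derivative g t) (at t)"
    if t: "\<bar>t\<bar> < a / 2" for t
  proof (rule has_field_derivative_transform_within_open[OF B_deriv])
    show "open {- a <..< a}" "t \<in> {- a <..< a}" "\<bar>t\<bar> < a" using t by auto
    show "B s = expectation (\<lambda>\<omega>. exp (s * W \<omega>))" if "s \<in> {- a <..< a}" for s
      using mgf[of s] that by auto
  qed
  have h: "0 < a / 2" using a by simp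
  have int: "integrable M (\<lambda>\<omega>. exp (t * W \<omega>))" if "\<bar>t\<bar> \<le> a / 2" for t
    using mgf[of t] that a by auto
  note mom = moments_from_mgf[OF W_meas h int deriv g_deriv]
  show W1: "integrable M W" and W2: "integrable M (\<lambda>\<omega>. (W \<omega>)\<^sup>2)" using mom by auto
  show EW: "expectation W = 2 * (Digamma a - Digamma (2 * a))"
    using mom(3) by (simp add: g_def B0)
  show "variance W = 2 * Polygamma 1 a - 4 * Polygamma 1 (2 * a)"
    using variance_eq[OF W1 W2] mom(4) unfolding EW d_def by linarith
qed

section \<open>Quantiles and cells of the centring distribution\<close>

text \<open>Right continuity of the distribution function makes the infimum in
  \<open>quantile\<close> attained. The levels 0 and 1 are excluded because \<open>quantile\<close>
  is infinite there by convention.\<close>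

lemma quantile_Galois:
  assumes "real_distribution F0" "0 < p" "p < 1"
  shows "quantile F0 p \<le> ereal x \<longleftrightarrow> p \<le> cdf F0 x"
proof -
  interpret cdf_distribution F0 unfolding cdf_distribution_def by fact
  show ?thesis using pseudoinverse[of p x] assms(2,3) by (simp add: quantile_def)
qed

lemma quantile_mono:
  assumes F0: "real_distribution F0" and "p \<le> q"
  shows "quantile F0 p \<le> quantile F0 q"
proof (cases "0 < p \<and> q < 1")
  case True
  then obtain x where x: "quantile F0 q = ereal x"
    using assms by (simp add: quantile_def)
  then have "q \<le> cdf F0 x"
    using quantile_Galois[OF F0, of q x] True assms by auto
  then show ?thesis
    using quantile_Galois[OF F0, of p x] True assms x by auto
qed (use assms in \<open>auto simp: quantile_def\<close>)

text \<open>One inequality is \<open>quantile_Galois\<close> at \<open>x\<close>. For the other, the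
  distribution function stays below \<open>p\<close> to the left of \<open>x\<close>, and without
  atoms it cannot jump at \<open>x\<close>.\<close>

lemma cdf_at_quantile:
  assumes F0: "real_distribution F0" and atomless: "\<And>x. measure F0 {x} = 0"
    and p: "0 < p" "p < 1" and x: "quantile F0 p = ereal x"
  shows "cdf F0 x = p"
proof (rule antisym)
  interpret real_distribution F0 by fact
  have "isCont (cdf F0) x" using atomless isCont_cdf by simp
  then have "(cdf F0 \<longlongrightarrow> cdf F0 x) (at_left x)"
    by (simp add: isCont_def filterlim_at_split)
  moreover have "\<forall>\<^sub>F y in at_left x. cdf F0 y \<le> p"
    unfolding eventually_at_filter
  proof (intro always_eventually allI impI)
    fix y assume "y \<noteq> x" "y \<in> {..<x}"
    then have "\<not> quantile F0 p \<le> ereal y" using x by simp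
    then show "cdf F0 y \<le> p" using quantile_Galois[OF F0 p] by simp
  qed
  ultimately show "cdf F0 x \<le> p"
    by (rule tendsto_upperbound) simp
  show "p \<le> cdf F0 x" using quantile_Galois[OF F0 p, of x] x by simp
qed

text \<open>At levels 0 and 1 the infinite quantiles make the set empty or the whole line; in
  between it is a half-line evaluated by \<open>cdf_at_quantile\<close>.\<close>

lemma measure_le_quantile:
  assumes F0: "real_distribution F0" and atomless: "\<And>x. measure F0 {x} = 0"
    and p: "0 \<le> p" "p \<le> 1"
  shows "measure F0 {x. ereal x \<le> quantile F0 p} = p"
proof -
  interpret real_distribution F0 by fact
  consider "p = 0" | "p = 1" | "0 < p" "p < 1" using p by linarith
  then show ?thesis
  proof cases
    case 2
    then show ?thesis using prob_space by (simp add: quantile_def)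
  next
    case 3
    then obtain x where x: "quantile F0 p = ereal x" by (simp add: quantile_def)
    then have "{y. ereal y \<le> quantile F0 p} = {..x}" by auto
    then show ?thesis using cdf_at_quantile[OF F0 atomless 3 x] by (simp add: cdf_def)
  qed (simp add: quantile_def)
qed

lemma sets_ereal_Iic [measurable]: "{x. ereal x \<le> c} \<in> sets borel"
proof -
  have "Measurable.pred borel (\<lambda>x. ereal x \<le> c)" by measurable
  then show ?thesis by (simp add: pred_def)
qed

text \<open>In this form both sets have masses given by \<open>measure_le_quantile\<close>, and
  measurability of the cell is immediate.\<close>

lemma pt_cell_diff:
  "pt_cell F0 m j = {x. ereal x \<le> quantile F0 (real j / 2 ^ m)}
     - {x. ereal x \<le> quantile F0 ((real j - 1) / 2 ^ m)}"
  by (auto simp: pt_cell_def)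

lemma sets_pt_cell [measurable]: "pt_cell F0 m j \<in> sets borel"
  unfolding pt_cell_diff by measurable

lemma measure_pt_cell:
  assumes F0: "real_distribution F0" and atomless: "\<And>x. measure F0 {x} = 0"
    and j: "j \<in> {1..2 ^ m}"
  shows "measure F0 (pt_cell F0 m j) = 1 / 2 ^ m"
proof -
  interpret real_distribution F0 by fact
  have "real j \<le> real (2 ^ m)" using j unfolding of_nat_le_iff by simp
  then have le: "real j \<le> 2 ^ m" by simp
  then have le': "real j - 1 \<le> 2 ^ m" by linarith
  have "real j / 2 ^ m \<le> 1" "(real j - 1) / 2 ^ m \<le> 1"
    using le le' by (simp_all add: divide_le_eq_1_pos)
  then have q: "measure F0 {x. ereal x \<le> quantile F0 (real j / 2 ^ m)} = real j / 2 ^ m"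
    "measure F0 {x. ereal x \<le> quantile F0 ((real j - 1) / 2 ^ m)} = (real j - 1) / 2 ^ m"
    using j by (auto intro!: measure_le_quantile[OF F0 atomless])
  have mono: "quantile F0 ((real j - 1) / 2 ^ m) \<le> quantile F0 (real j / 2 ^ m)"
    by (intro quantile_mono F0 divide_right_mono) auto
  have "measure F0 (pt_cell F0 m j) = real j / 2 ^ m - (real j - 1) / 2 ^ m"
    unfolding pt_cell_diff using mono
    by (subst finite_measure_Diff)
       (auto simp: q)
  then show ?thesis by (simp add: diff_divide_distrib)
qed

text \<open>This makes the definite description in \<open>pt_index\<close> meaningful. The index is
  the least \<open>j\<close> whose upper quantile reaches \<open>x\<close>: 2 ^ m qualifies because
  its quantile is infinite, and 0 never does because its quantile is minus infinity. Monotone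
  quantiles keep two different cells apart.\<close>

lemma pt_cell_ex1:
  assumes F0: "real_distribution F0"
  shows "\<exists>!j. j \<in> {1..2 ^ m} \<and> x \<in> pt_cell F0 m j"
proof (rule ex_ex1I)
  let ?P = "\<lambda>j. ereal x \<le> quantile F0 (real j / 2 ^ m)"
  have top: "?P (2 ^ m)" by (simp add: quantile_def)
  define j where "j = (LEAST j. ?P j)"
  have j: "?P j" unfolding j_def using top by (rule LeastI)
  have j_le: "j \<le> 2 ^ m" unfolding j_def using top by (rule Least_le)
  have j0: "j \<noteq> 0"
  proof
    assume "j = 0"
    then show False using j by (simp add: quantile_def)
  qed
  then have "\<not> ?P (j - 1)" unfolding j_def by (intro not_less_Least) simp
  moreover have "real (j - 1) = real j - 1" using j0 by (simp add: of_nat_diff)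
  ultimately have "x \<in> pt_cell F0 m j" using j by (simp add: pt_cell_def)
  then show "\<exists>j. j \<in> {1..2 ^ m} \<and> x \<in> pt_cell F0 m j" using j_le j0 by (intro exI[of _ j]) auto
next
  have *: False if "i < j" "x \<in> pt_cell F0 m i" "x \<in> pt_cell F0 m j" for i j
  proof -
    have "real i \<le> real j - 1" using that(1) by linarith
    then have "quantile F0 (real i / 2 ^ m) \<le> quantile F0 ((real j - 1) / 2 ^ m)"
      by (intro quantile_mono F0 divide_right_mono) auto
    then show False using that(2,3) by (auto simp: pt_cell_def)
  qed
  then show "i = j" if "i \<in> {1..2 ^ m} \<and> x \<in> pt_cell F0 m i"
    "j \<in> {1..2 ^ m} \<and> x \<in> pt_cell F0 m j" for i j
    using that by (metis linorder_neqE_nat)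
qed

text \<open>Replacing the index lookup by a finite combination of cell indicators makes integration
  over \<open>x\<close> and joint measurability accessible.\<close>

lemma sum_pt_index:
  fixes h :: "nat \<Rightarrow> real"
  assumes F0: "real_distribution F0"
  shows "h (pt_index F0 m x) = (\<Sum>j = 1..2 ^ m. h j * indicator (pt_cell F0 m j) x)"
proof -
  let ?i = "pt_index F0 m x"
  have i: "?i \<in> {1..2 ^ m}" "x \<in> pt_cell F0 m ?i"
    using theI'[OF pt_cell_ex1[OF F0, of m x]] by (auto simp: pt_index_def)
  have "h j * indicator (pt_cell F0 m j) x = (if j = ?i then h j else 0)" if "j \<in> {1..2 ^ m}" for j
    using i that pt_cell_ex1[OF F0, of m x] by (auto simp: indicator_def)
  then show ?thesis using i(1) by simp
qed

lemma sum_odd_even: "(\<Sum>j = 1..2 * n. h j) = (\<Sum>j = 1..n. h (2 * j - 1) + h (2 * j))"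
  for h :: "nat \<Rightarrow> 'b::comm_monoid_add"
  by (induction n) (simp_all add: add.assoc)

section \<open>Mean and variance of the divergence\<close>

theorem proposition1:
  fixes M :: nat and \<alpha> :: real and \<rho> :: "nat \<Rightarrow> real"
    and F0 :: "real measure" and f0 :: "real \<Rightarrow> real"
    and P :: "'a measure" and Y :: "nat \<Rightarrow> nat \<Rightarrow> 'a \<Rightarrow> real"
    and F :: "'a \<Rightarrow> real measure" and f :: "'a \<Rightarrow> real \<Rightarrow> real"
  assumes "M \<ge> 1" and "\<alpha> > 0" and "\<And>m. m \<ge> 1 \<Longrightarrow> \<rho> m > 0"
    and "prob_space F0" and "f0 \<in> borel_measurable borel" and "\<And>x. f0 x \<ge> 0"
    and "F0 = density lborel f0"
    and "finite_polya_tree P M \<alpha> \<rho> F0 f0 Y F f"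
  shows "(AE \<omega> in P. integrable lborel (\<lambda>x. ln (f0 x / f \<omega> x) * f0 x) \<and>
           KL f0 (f \<omega>) =
             - (\<Sum>m = 1..M. \<Sum>j = 1..2 ^ m. ln (Y m j \<omega>) * (1 / 2 ^ m)) - real M * ln 2) \<and>
         integrable P (\<lambda>\<omega>. KL f0 (f \<omega>)) \<and>
         integrable P (\<lambda>\<omega>. (KL f0 (f \<omega>))\<^sup>2) \<and>
         prob_space.expectation P (\<lambda>\<omega>. KL f0 (f \<omega>)) =
           (\<Sum>m = 1..M. (Digamma (2 * \<alpha> * \<rho> m) - Digamma (\<alpha> * \<rho> m) - ln 2)) \<and>
         prob_space.variance P (\<lambda>\<omega>. KL f0 (f \<omega>)) =
           (\<Sum>m = 1..M. 1 / 2 ^ m * (Polygamma 1 (\<alpha> * \<rho> m) - 2 * Polygamma 1 (2 * \<alpha> * \<rho> m)))"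
proof -
  interpret finite_polya_tree P M \<alpha> \<rho> F0 f0 Y F f by fact
  note [measurable] = assms(5)
  have rd: "real_distribution F0"
    using assms(4,7) by (simp add: real_distribution_def real_distribution_axioms_def)
  interpret F0: real_distribution F0 by fact
  have f0_cell: "has_bochner_integral lborel (\<lambda>x. indicator A x * f0 x) (measure F0 A)"
    if [measurable]: "A \<in> sets borel" for A
  proof (rule has_bochner_integral_nn_integral)
    have "(\<integral>\<^sup>+ x. ennreal (indicator A x * f0 x) \<partial>lborel) = emeasure (density lborel f0) A"
      by (subst emeasure_density) (auto intro!: nn_integral_cong split: split_indicator)
    then show "(\<integral>\<^sup>+ x. ennreal (indicator A x * f0 x) \<partial>lborel) = ennreal (measure F0 A)"
      using F0.emeasure_eq_measure assms(7) by simp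
  qed (use assms(6) in auto)
  have atomless: "measure F0 {x} = 0" for x
  proof -
    have "AE y in lborel. indicator {x} y * f0 y = 0"
      using AE_lborel_singleton[of x] by eventually_elim simp
    then have "(\<integral>y. indicator {x} y * f0 y \<partial>lborel) = 0"
      by (rule integral_eq_zero_AE)
    then show ?thesis using has_bochner_integral_integral_eq[OF f0_cell[of "{x}"]] by simp
  qed
  \<comment> \<open>A pair (m, j) in \<open>I\<close> stands for the siblings 2 * j - 1 and 2 * j of
    level m, both determined by one Beta variable.\<close>
  define I where "I = (SIGMA m:{1..M}. {1..2 ^ (m - 1) :: nat})"
  have fin: "finite I" by (auto simp: I_def)
  let ?Y = "\<lambda>i. Y (fst i) (2 * snd i - 1)"
  have Y_dist: "distributed P lborel (?Y i) (beta_density (\<alpha> * \<rho> (fst i)) (\<alpha> * \<rho> (fst i)))"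
    if "i \<in> I" for i
    using Y_beta[of "fst i" "snd i"] that by (auto simp: I_def)
  have pos: "0 < \<alpha> * \<rho> (fst i)" if "i \<in> I" for i
    using that assms(2,3) by (auto simp: I_def)
  have pair: "(\<Sum>m = 1..M. \<Sum>j = 1..2 ^ m. h m j) =
      (\<Sum>i\<in>I. h (fst i) (2 * snd i - 1) + h (fst i) (2 * snd i))" for h :: "nat \<Rightarrow> nat \<Rightarrow> real"
  proof -
    have "(\<Sum>m = 1..M. \<Sum>j = 1..2 ^ m. h m j) =
        (\<Sum>m = 1..M. \<Sum>j = 1..2 ^ (m - 1). h m (2 * j - 1) + h m (2 * j))"
    proof (rule sum.cong)
      fix m assume "m \<in> {1..M}"
      then have "(2::nat) ^ m = 2 * 2 ^ (m - 1)" by (cases m) auto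
      then show "(\<Sum>j = 1..2 ^ m. h m j) =
          (\<Sum>j = 1..2 ^ (m - 1). h m (2 * j - 1) + h m (2 * j))"
        by (simp only: sum_odd_even)
    qed simp
    then show ?thesis by (simp add: I_def sum.Sigma split_def)
  qed
  \<comment> \<open>Every branch \<open>j\<close> belongs to the sibling pair number (j + 1) div
    2.\<close>
  have cover: "\<exists>i\<in>I. fst i = m \<and> (j = 2 * snd i - 1 \<or> j = 2 * snd i)"
    if m: "m \<in> {1..M}" and j: "j \<in> {1..2 ^ m}" for m j
  proof -
    have "(2::nat) ^ m = 2 * 2 ^ (m - 1)" using m by (cases m) auto
    then have "(m, (j + 1) div 2) \<in> I" using m j by (auto simp: I_def)
    moreover have "j = 2 * ((j + 1) div 2) - 1 \<or> j = 2 * ((j + 1) div 2)" by presburger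
    ultimately show ?thesis by (intro bexI[of _ "(m, (j + 1) div 2)"]) auto
  qed
  have Y_compl: "Y (fst i) (2 * snd i) \<omega> = 1 - ?Y i \<omega>" if "i \<in> I" "\<omega> \<in> space P" for i \<omega>
    using Y_even[of "fst i" "snd i" \<omega>] that by (auto simp: I_def)
  have Y_odd_meas: "random_variable borel (?Y i)" if "i \<in> I" for i
    using distributed_measurable[OF Y_dist[OF that]] by simp
  have Y_meas: "random_variable borel (Y m j)" if mj: "m \<in> {1..M}" "j \<in> {1..2 ^ m}" for m j
  proof -
    obtain i where i: "i \<in> I" "fst i = m" "j = 2 * snd i - 1 \<or> j = 2 * snd i"
      using cover[OF mj] by blast
    have "random_variable borel (\<lambda>\<omega>. 1 - ?Y i \<omega>)"
      using Y_odd_meas[OF i(1)] by measurable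
    then have "random_variable borel (Y (fst i) (2 * snd i))"
      using Y_compl[OF i(1)] by (subst measurable_cong) auto
    then show ?thesis using Y_odd_meas[OF i(1)] i by auto
  qed
  \<comment> \<open>The density vanishes outside the open unit interval, so almost surely both
    siblings are positive and the product rule for \<open>ln\<close> applies.\<close>
  have "AE \<omega> in P. \<forall>i\<in>I. 0 < ?Y i \<omega> \<and> ?Y i \<omega> < 1"
  proof (rule AE_finite_allI[OF fin])
    fix i assume i: "i \<in> I"
    show "AE \<omega> in P. 0 < ?Y i \<omega> \<and> ?Y i \<omega> < 1"
      by (subst distributed_AE2[OF Y_dist[OF i]]) (auto simp: beta_density_def intro!: AE_I2)
  qed
  then have Y_pos: "AE \<omega> in P. \<forall>m\<in>{1..M}. \<forall>j\<in>{1..2 ^ m}. 0 < Y m j \<omega>"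
    using AE_space
  proof eventually_elim
    case (elim \<omega>)
    show ?case
    proof (intro ballI)
      fix m j :: nat assume "m \<in> {1..M}" "j \<in> {1..2 ^ m}"
      from cover[OF this] obtain i where "i \<in> I" "fst i = m" "j = 2 * snd i - 1 \<or> j = 2 * snd i"
        by blast
      then show "0 < Y m j \<omega>" using elim Y_compl[of i \<omega>] by auto
    qed
  qed
  let ?K = "\<lambda>\<omega>. - (\<Sum>m = 1..M. \<Sum>j = 1..2 ^ m. ln (Y m j \<omega>) * (1 / 2 ^ m)) - real M * ln 2"
  let ?c = "\<lambda>m j. indicator (pt_cell F0 m j) :: real \<Rightarrow> real"
  have KL: "has_bochner_integral lborel (\<lambda>x. ln (f0 x / f \<omega> x) * f0 x) (?K \<omega>)"
    if pos: "\<forall>m\<in>{1..M}. \<forall>j\<in>{1..2 ^ m}. 0 < Y m j \<omega>" and \<omega>: "\<omega> \<in> space P" for \<omega>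
  proof -
    \<comment> \<open>The factor \<open>indicator UNIV x\<close> lets \<open>f0_cell\<close>
      integrate the constant term too, with total mass 1.\<close>
    have eq: "ln (f0 x / f \<omega> x) * f0 x =
        - (\<Sum>m = 1..M. \<Sum>j = 1..2 ^ m. ln (Y m j \<omega>) * (?c m j x * f0 x))
          - real M * ln 2 * (indicator UNIV x * f0 x)" for x
    \<comment> \<open>Cancelling \<open>f0 x\<close> inside the logarithm needs it to be nonzero;
      where it is zero, both sides vanish through the factor \<open>f0 x\<close>.\<close>
    proof (cases "f0 x = 0")
      case False
      have Yp: "0 < Y m (pt_index F0 m x) \<omega>" if "m \<in> {1..M}" for m
        using theI'[OF pt_cell_ex1[OF rd, of m x]] pos that by (auto simp: pt_index_def)
      let ?p = "\<Prod>m = 1..M. Y m (pt_index F0 m x) \<omega>"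
      have ln_f: "ln (f0 x / (p * 2 ^ M * f0 x)) = - (ln p + real M * ln 2)" if "0 < p" for p
        using False that by (simp add: ln_div ln_mult ln_realpow)
      have "0 < ?p" using Yp by (intro prod_pos) auto
      then have "ln (f0 x / f \<omega> x) = - (ln ?p + real M * ln 2)"
        unfolding f_eq[OF \<omega>] by (rule ln_f)
      also have "ln ?p = (\<Sum>m = 1..M. ln (Y m (pt_index F0 m x) \<omega>))"
        using Yp by (intro ln_prod) (simp, metis less_irrefl)
      also have "\<dots> = (\<Sum>m = 1..M. \<Sum>j = 1..2 ^ m. ln (Y m j \<omega>) * ?c m j x)"
        using sum_pt_index[OF rd, of "\<lambda>j. ln (Y _ j \<omega>)"] by simp
      finally show ?thesis
        by (simp only: indicator_UNIV sum_distrib_right minus_add_distrib distrib_right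
            mult_minus_left mult.assoc mult_1_left diff_conv_add_uminus UNIV_I if_True)
    qed simp
    have "has_bochner_integral lborel (\<lambda>x. - (\<Sum>m = 1..M. \<Sum>j = 1..2 ^ m.
            ln (Y m j \<omega>) * (?c m j x * f0 x)) - real M * ln 2 * (indicator UNIV x * f0 x))
        (- (\<Sum>m = 1..M. \<Sum>j = 1..2 ^ m. ln (Y m j \<omega>) * measure F0 (pt_cell F0 m j))
          - real M * ln 2 * measure F0 UNIV)"
      by (intro has_bochner_integral_diff has_bochner_integral_minus has_bochner_integral_sum
          has_bochner_integral_mult_right f0_cell) auto
    then show ?thesis
      unfolding eq using F0.prob_space by (simp add: measure_pt_cell[OF rd atomless])
  qed
  have KL_AE: "AE \<omega> in P. integrable lborel (\<lambda>x. ln (f0 x / f \<omega> x) * f0 x) \<and> KL f0 (f \<omega>) = ?K \<omega>"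
    using Y_pos AE_space
    by eventually_elim (use KL in \<open>simp add: KL_def has_bochner_integral_iff\<close>)
  \<comment> \<open>The closed form holds only almost surely and \<open>P\<close> need not be complete, so measurability is
    derived from that of the integrand on the product space.\<close>
  have KL_meas: "random_variable borel (\<lambda>\<omega>. KL f0 (f \<omega>))"
  proof -
    \<comment> \<open>\<open>?f\<close> is the random density with the index lookup expanded by
      \<open>sum_pt_index\<close>. It agrees with \<open>f\<close> at every point of
      \<open>space P\<close>, so no null set enters.\<close>
    let ?f = "\<lambda>\<omega> x. (\<Prod>m = 1..M. \<Sum>j = 1..2 ^ m. Y m j \<omega> * ?c m j x) * 2 ^ M * f0 x"
    have "(\<lambda>(\<omega>, x). ?f \<omega> x) \<in> borel_measurable (P \<Otimes>\<^sub>M lborel)"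
      unfolding split_def
      by (intro borel_measurable_times borel_measurable_prod borel_measurable_sum
          measurable_compose[OF measurable_fst Y_meas] borel_measurable_const) measurable
    then have "(\<lambda>(\<omega>, x). ln (f0 x / ?f \<omega> x) * f0 x) \<in> borel_measurable (P \<Otimes>\<^sub>M lborel)"
      unfolding split_def by measurable
    then have "random_variable borel (\<lambda>\<omega>. LINT x|lborel. ln (f0 x / ?f \<omega> x) * f0 x)"
      by (rule lborel.borel_measurable_lebesgue_integral)
    moreover have "KL f0 (f \<omega>) = (LINT x|lborel. ln (f0 x / ?f \<omega> x) * f0 x)"
      if "\<omega> \<in> space P" for \<omega>
      unfolding KL_def f_eq[OF that] sum_pt_index[OF rd, of "\<lambda>j. Y _ j \<omega>"] by (rule refl)
    ultimately show ?thesis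
      by (subst measurable_cong) assumption+
  qed
  \<comment> \<open>\<open>W i\<close> collects the contribution of one sibling pair. It is a
    function of a single Beta variable, so independence carries over.\<close>
  define W where "W = (\<lambda>i \<omega>. (- 1 / 2 ^ fst i) * (ln (?Y i \<omega>) + ln (1 - ?Y i \<omega>)))"
  define K where "K = (\<lambda>\<omega>. - (real M * ln 2) + (\<Sum>i\<in>I. W i \<omega>))"
  have K_eq: "?K \<omega> = K \<omega>" if "\<omega> \<in> space P" for \<omega>
  proof -
    have "(\<Sum>i\<in>I. W i \<omega>) =
        - (\<Sum>i\<in>I. ln (?Y i \<omega>) * (1 / 2 ^ fst i) + ln (Y (fst i) (2 * snd i) \<omega>) * (1 / 2 ^ fst i))"
      unfolding sum_negf[symmetric] W_def
      using Y_compl[OF _ that] by (intro sum.cong refl) (simp add: add_divide_distrib)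
    then show ?thesis unfolding pair K_def by simp
  qed
  have KL_K: "AE \<omega> in P. KL f0 (f \<omega>) = K \<omega>"
    using KL_AE AE_space by eventually_elim (simp only: K_eq)
  have W_indep: "indep_vars (\<lambda>_. borel) W I"
  proof -
    have "indep_vars (\<lambda>_. borel)
        (\<lambda>i \<omega>. (- 1 / 2 ^ fst i) * (ln (y i \<omega>) + ln (1 - y i \<omega>))) I"
      if "indep_vars (\<lambda>_. borel) y I" for y :: "nat \<times> nat \<Rightarrow> 'a \<Rightarrow> real"
      using that by (rule indep_vars_compose2) measurable
    from this[OF Y_indep[folded I_def]] show ?thesis by (simp add: W_def split_def)
  qed
  \<comment> \<open>The factor 2 / 2 ^ m is split off so that \<open>count\<close> can absorb it.
    Squaring the weight of \<open>W i\<close> yields 1 / 4 ^ m, so in the variance a further 1 / 2 ^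
    m survives.\<close>
  have W: "integrable P (W i)" "integrable P (\<lambda>\<omega>. (W i \<omega>)\<^sup>2)"
    "expectation (W i) = 2 / 2 ^ fst i *
       (Digamma (2 * \<alpha> * \<rho> (fst i)) - Digamma (\<alpha> * \<rho> (fst i)))"
    "variance (W i) = 2 / 2 ^ fst i * (1 / 2 ^ fst i *
       (Polygamma 1 (\<alpha> * \<rho> (fst i)) - 2 * Polygamma 1 (2 * \<alpha> * \<rho> (fst i))))"
    if i: "i \<in> I" for i
  proof -
    note m = beta_log_moments[OF pos[OF i] Y_dist[OF i]]
    show "integrable P (W i)" "integrable P (\<lambda>\<omega>. (W i \<omega>)\<^sup>2)"
      using m(1,2) unfolding W_def power_mult_distrib by simp_all
    show "expectation (W i) = 2 / 2 ^ fst i *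
        (Digamma (2 * \<alpha> * \<rho> (fst i)) - Digamma (\<alpha> * \<rho> (fst i)))"
      unfolding W_def using m(3) by (simp add: field_simps)
    have "variance (W i) = (- 1 / 2 ^ fst i)\<^sup>2 * variance (\<lambda>\<omega>. ln (?Y i \<omega>) + ln (1 - ?Y i \<omega>))"
      unfolding W_def using variance_affine_integrable[OF m(1), of 0 "- 1 / 2 ^ fst i"] by simp
    then show "variance (W i) = 2 / 2 ^ fst i * (1 / 2 ^ fst i *
        (Polygamma 1 (\<alpha> * \<rho> (fst i)) - 2 * Polygamma 1 (2 * \<alpha> * \<rho> (fst i))))"
      unfolding m(4) by (simp add: power2_eq_square field_simps)
  qed
  \<comment> \<open>Level m has 2 ^ (m - 1) sibling pairs, and 2 ^ (m - 1) * (2 / 2 ^ m) =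
    1.\<close>
  have count: "(\<Sum>i\<in>I. 2 / 2 ^ fst i * h (fst i)) = (\<Sum>m = 1..M. h m)" for h :: "nat \<Rightarrow> real"
  proof -
    have "(\<Sum>i\<in>I. 2 / 2 ^ fst i * h (fst i)) =
        (\<Sum>m = 1..M. \<Sum>j\<in>{1..2 ^ (m - 1) :: nat}. 2 / 2 ^ m * h m)"
      unfolding I_def by (subst sum.Sigma) (simp_all add: split_def)
    also have "\<dots> = (\<Sum>m = 1..M. h m)"
    proof (rule sum.cong)
      fix m assume "m \<in> {1..M}"
      then show "(\<Sum>j\<in>{1..2 ^ (m - 1) :: nat}. 2 / 2 ^ m * h m) = h m" by (cases m) auto
    qed simp
    finally show ?thesis .
  qed
  note S = indep_vars_sum_square_integrable_variance[OF fin W_indep W(1,2)]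
  have S1: "integrable P (\<lambda>\<omega>. \<Sum>i\<in>I. W i \<omega>)"
    using W(1) by (rule Bochner_Integration.integrable_sum)
  have K_int: "integrable P K" unfolding K_def using S1 by simp
  have K2_int: "integrable P (\<lambda>\<omega>. (K \<omega>)\<^sup>2)"
    unfolding K_def power2_sum using S1 S(1) by simp
  \<comment> \<open>Integrability and moments pass from \<open>K\<close> to the divergence by almost
    sure equality, with \<open>KL_meas\<close> supplying measurability.\<close>
  have "integrable P (\<lambda>\<omega>. KL f0 (f \<omega>))"
    using K_int by (rule integrable_cong_AE_imp) (use KL_meas KL_K in auto)
  moreover have "integrable P (\<lambda>\<omega>. (KL f0 (f \<omega>))\<^sup>2)"
    using K2_int by (rule integrable_cong_AE_imp) (use KL_meas KL_K in auto)
  moreover have E_eq: "expectation (\<lambda>\<omega>. KL f0 (f \<omega>)) = expectation K"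
    using KL_meas KL_K borel_measurable_integrable[OF K_int] by (intro integral_cong_AE) auto
  moreover have "variance (\<lambda>\<omega>. KL f0 (f \<omega>)) = variance K"
    unfolding E_eq using KL_meas KL_K borel_measurable_integrable[OF K_int]
    by (intro integral_cong_AE) auto
  moreover have "expectation K =
      (\<Sum>m = 1..M. (Digamma (2 * \<alpha> * \<rho> m) - Digamma (\<alpha> * \<rho> m) - ln 2))"
  proof -
    have "expectation K = (\<Sum>i\<in>I. expectation (W i)) - real M * ln 2"
      unfolding K_def using S1 W(1) prob_space by simp
    then show ?thesis
      using count[of "\<lambda>m. Digamma (2 * \<alpha> * \<rho> m) - Digamma (\<alpha> * \<rho> m)"]
      by (simp add: W(3) sum_subtractf)
  qed
  moreover have "variance K =
      (\<Sum>m = 1..M. 1 / 2 ^ m * (Polygamma 1 (\<alpha> * \<rho> m) - 2 * Polygamma 1 (2 * \<alpha> * \<rho> m)))"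
  proof -
    have "variance K = (\<Sum>i\<in>I. variance (W i))"
      unfolding K_def using variance_affine_integrable[OF S1, of "- (real M * ln 2)" 1] S(2) by simp
    also have "\<dots> = (\<Sum>i\<in>I. 2 / 2 ^ fst i * (1 / 2 ^ fst i *
       (Polygamma 1 (\<alpha> * \<rho> (fst i)) - 2 * Polygamma 1 (2 * \<alpha> * \<rho> (fst i)))))"
      using W(4) by (rule sum.cong[OF refl])
    also note count[of "\<lambda>m. 1 / 2 ^ m *
       (Polygamma 1 (\<alpha> * \<rho> m) - 2 * Polygamma 1 (2 * \<alpha> * \<rho> m))"]
    finally show ?thesis .
  qed
  ultimately show ?thesis using KL_AE by simp
qed

end
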